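(* Let $\Omega \subset \mathbb{RP}^n$ be a strictly convex divisible domain. Then for any $x_0 \in \Omega$, the space $\big(\Omega, M_\Omega(x_0,\cdot)\big)$ is $\beta$-uniformly convex for some $\beta \in [2,\infty)$. That is, there exist $\beta \in [2,\infty)$ and $C>0$ such that, writing $\|v\| := M_\Omega(x_0,v)$, the modulus of convexity $$\delta(\varepsilon) = \inf\Big\{\,1 - \tfrac{\|x+y\|}{2} \;:\; \|x\|\le 1,\ \|y\|\le 1,\ \|x-y\|\ge \varepsilon \Big\}$$ satisfies $\delta(\varepsilon) \ge C\varepsilon^\beta$ for all $\varepsilon \in [0,2]$.
   Context: A subset $\Omega \subset \mathbb{RP}^n$ is properly convex if its closure is contained in some affine chart $\mathbb{R}^n \subset \mathbb{RP}^n$ and it is convex there; it is strictly convex if moreover its boundary $\partial\Omega$ contains no nontrivial line segment. A divisible convex set (divisible domain) is a properly convex open subset $\Omega \subset \mathbb{RP}^n$ for which there exists a discrete group $\Gamma$ of projective transformations preserving $\Omega$ and acting cocompactly on $\Omega$. Working in an affine chart $\mathbb{R}^n$ containing $\overline{\Omega}$, for a basepoint $x_0 \in \Omega$ and a vector $v \in T_{x_0}\Omega \cong \mathbb{R}^n$, the Minkowski functional is $M_\Omega(x_0,v) := \inf\{a>0 : x_0 + \tfrac{1}{a}v \in \Omega\}$ (so vectors are based at $x_0$ and the unit ball of $M_\Omega(x_0,\cdot)$ is $\Omega$ translated so that $x_0$ is the origin). This functional is positively homogeneous but in general not symmetric; $\beta$-uniform convexity is defined for it by the modulus-of-convexity condition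 stated in the claim, with $\|\cdot\| = M_\Omega(x_0,\cdot)$. *)

theory Defs
  imports "HOL-Analysis.Analysis"
begin

text \<open>RP^n is modelled via homogeneous coordinates in real^('n::finite option) (dimension n+1);
  the affine chart is {x_None \<noteq> 0}, identified with real^('n::finite) via x \<mapsto> [x : 1].\<close>

definition lift :: "real^('n::finite) \<Rightarrow> real^('n::finite option)" where
  "lift x = (\<chi> i. case i of None \<Rightarrow> 1 | Some j \<Rightarrow> x $ j)"

definition pact :: "real^('n::finite option)^('n::finite option) \<Rightarrow> real^('n::finite) \<Rightarrow> real^'n" where
  "pact g x = (\<chi> j. (g *v lift x) $ (Some j) / (g *v lift x) $ None)"

text \<open>Properly convex open set, seen in an affine chart containing its closure.\<close>
definition properly_convex_open :: "(real^('n::finite)) set \<Rightarrow> bool" where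
  "properly_convex_open \<Omega> \<longleftrightarrow> open \<Omega> \<and> \<Omega> \<noteq> {} \<and> convex \<Omega> \<and> bounded \<Omega>"

definition strictly_convex :: "(real^('n::finite)) set \<Rightarrow> bool" where
  "strictly_convex \<Omega> \<longleftrightarrow> properly_convex_open \<Omega> \<and>
     (\<forall>a b. a \<noteq> b \<longrightarrow> \<not> closed_segment a b \<subseteq> frontier \<Omega>)"

text \<open>A group of projective transformations, lifted to matrices with det = +-1.\<close>
definition proj_group :: "(real^('n::finite option)^('n::finite option)) set \<Rightarrow> bool" where
  "proj_group \<Gamma> \<longleftrightarrow> mat 1 \<in> \<Gamma> \<and> (\<forall>g\<in>\<Gamma>. \<forall>h\<in>\<Gamma>. g ** h \<in> \<Gamma>) \<and>
     (\<forall>g\<in>\<Gamma>. invertible g \<and> matrix_inv g \<in> \<Gamma> \<and> \<bar>det g\<bar> = 1)"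

definition preserves :: "(real^('n::finite option)^('n::finite option)) set \<Rightarrow> (real^('n::finite)) set \<Rightarrow> bool" where
  "preserves \<Gamma> \<Omega> \<longleftrightarrow> (\<forall>g\<in>\<Gamma>. (\<forall>x\<in>\<Omega>. (g *v lift x) $ None \<noteq> 0) \<and> pact g ` \<Omega> = \<Omega>)"

definition divisible :: "(real^('n::finite)) set \<Rightarrow> bool" where
  "divisible \<Omega> \<longleftrightarrow> properly_convex_open \<Omega> \<and>
     (\<exists>\<Gamma>. proj_group \<Gamma> \<and> discrete \<Gamma> \<and> preserves \<Gamma> \<Omega> \<and>
        (\<exists>K. compact K \<and> K \<subseteq> \<Omega> \<and> (\<Union>g\<in>\<Gamma>. pact g ` K) = \<Omega>))"

definition minkowski :: "(real^('n::finite)) set \<Rightarrow> real^('n::finite) \<Rightarrow> real^('n::finite) \<Rightarrow> real" where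
  "minkowski \<Omega> x0 v = Inf {a. a > 0 \<and> x0 + (1/a) *\<^sub>R v \<in> \<Omega>}"

text \<open>Modulus of convexity (infimum of the empty set is +\<infinity>).\<close>
definition modulus_of_convexity :: "(real^('n::finite) \<Rightarrow> real) \<Rightarrow> real \<Rightarrow> ereal" where
  "modulus_of_convexity N \<epsilon> = Inf {ereal (1 - N (x + y) / 2) | x y.
      N x \<le> 1 \<and> N y \<le> 1 \<and> N (x - y) \<ge> \<epsilon>}"

end

theory Submission
  imports Defs
begin

text \<open>
  Let \<open>\<phi>\<close> be an affine function that is nonnegative on \<open>\<Omega>\<close>, vanishes at a boundary point \<open>p\<close>
  and equals 1 at the base point. The heart of the matter is that the diameter of the section
  \<open>\<phi> = s\<close> decays like a power of \<open>s\<close>, uniformly in \<open>\<phi>\<close>. It suffices to find \<open>\<kappa> < 1\<close> such that a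
  chord at height \<open>\<kappa> s\<close> is at most half as long as some parallel chord at height \<open>s\<close>.
  For this, take the parallel chord through the point at height \<open>s\<close> of the segment from \<open>p\<close> to
  the base point, and move its midpoint into a fixed compact set by a projective transformation
  preserving \<open>\<Omega>\<close>. In homogeneous coordinates parallelism and ratios of parallel chords are
  linear relations, so they survive the transformation. The supporting hyperplane becomes the zero
  set of a functional from a compact family, and strict convexity makes its small sublevel sets in
  \<open>\<Omega>\<close> uniformly small. Hence the image of the lower chord is short while the image of the
  upper chord is long.

  If \<open>x\<close> and \<open>y\<close> are in the closed unit ball of the Minkowski functional, choose \<open>p\<close> on the ray
  through their midpoint. Then \<open>1 - \<parallel>x + y\<parallel> / 2\<close> is the height of the midpoint, so both points lie in
  a cap of twice that height.
\<close>

subsection \<open>Homogeneous coordinates\<close>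

lemma lift_nth [simp]: "lift x $ None = 1" "lift x $ Some j = x $ j"
  by (simp_all add: lift_def)

lemma lift_eq_iff [simp]: "lift x = lift y \<longleftrightarrow> x = y"
  by (metis lift_nth(2) vec_eq_iff)

lemma sum_UNIV_option:
  fixes f :: "'n::finite option \<Rightarrow> real"
  shows "(\<Sum>i\<in>UNIV. f i) = f None + (\<Sum>j\<in>UNIV. f (Some j))"
  by (simp add: UNIV_option_conv sum.reindex)

lemma inner_lift:
  "w \<bullet> lift x = w $ None + (\<chi> j. w $ Some j) \<bullet> x"
  by (simp add: inner_vec_def sum_UNIV_option)

lemma norm_lift_diff: "norm (lift x - lift y) = norm (x - y)"
  by (simp add: norm_eq_sqrt_inner inner_vec_def sum_UNIV_option)

lemma norm_lift_le: "norm (lift x) \<le> 1 + norm x"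
proof -
  have "(norm (lift x))\<^sup>2 = 1 + (norm x)\<^sup>2"
    by (simp add: power2_norm_eq_inner inner_vec_def sum_UNIV_option)
  also have "\<dots> \<le> (1 + norm x)\<^sup>2"
    by (simp add: power2_sum)
  finally show ?thesis
    by (rule power2_le_imp_le) simp
qed

lemma norm_option_le:
  fixes w :: "real^('n::finite option)"
  shows "norm w \<le> \<bar>w $ None\<bar> + norm (\<chi> j. w $ Some j)"
proof -
  have "(norm w)\<^sup>2 = \<bar>w $ None\<bar>\<^sup>2 + (norm (\<chi> j. w $ Some j))\<^sup>2"
    by (simp add: power2_norm_eq_inner inner_vec_def sum_UNIV_option flip: power2_eq_square)
  also have "\<dots> \<le> (\<bar>w $ None\<bar> + norm (\<chi> j. w $ Some j))\<^sup>2"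
    by (simp add: power2_sum)
  finally show ?thesis
    by (rule power2_le_imp_le) simp
qed

lemma continuous_on_lift [continuous_intros]:
  fixes f :: "'a::topological_space \<Rightarrow> real^'n"
  assumes "continuous_on S f"
  shows "continuous_on S (\<lambda>x. lift (f x))"
proof -
  have "continuous_on T (lift :: real^'n \<Rightarrow> _)" for T
    unfolding continuous_on_iff dist_norm norm_lift_diff by blast
  then show ?thesis
    using assms by (rule continuous_on_compose2) auto
qed

lemma lift_affine:
  "u + v = 1 \<Longrightarrow> lift (u *\<^sub>R x + v *\<^sub>R y) = u *\<^sub>R lift x + v *\<^sub>R lift y"
  by (auto simp: vec_eq_iff lift_def split: option.split)

lemma pact_eqI: "g *v lift x = c *\<^sub>R lift y \<Longrightarrow> c \<noteq> 0 \<Longrightarrow> pact g x = y"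
  by (simp add: pact_def vec_eq_iff)

lemma matrix_lift_eq_pact:
  "(g *v lift x) $ None \<noteq> 0 \<Longrightarrow> g *v lift x = (g *v lift x) $ None *\<^sub>R lift (pact g x)"
  by (auto simp: vec_eq_iff pact_def lift_def split: option.split)

subsection \<open>Functionals supporting a strictly convex cocompact domain\<close>

text \<open>Isolates what the dividing group supplies. \<open>G\<close> is a projective action on
  the closure and \<open>T\<close> a linear lift of it, scaled so that the factor
  \<open>\<alpha>\<close> is 1 at \<open>m\<close>. Positive factors let sign conditions pass
  through \<open>G\<close>; the last clause keeps transported chord endpoints outside
  \<open>\<Omega>\<close>.\<close>

locale strictly_convex_cocompact =
  fixes \<Omega> K :: "(real^'n) set"
  assumes open_dom: "open \<Omega>" and convex_dom: "convex \<Omega>" and bounded_dom: "bounded \<Omega>"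
    and no_segment: "\<And>a b. a \<noteq> b \<Longrightarrow> \<not> closed_segment a b \<subseteq> frontier \<Omega>"
    and compact_core: "compact K" and core_subset: "K \<subseteq> \<Omega>"
    and move_to_core: "\<And>m. m \<in> \<Omega> \<Longrightarrow> \<exists>T \<alpha> G. linear T \<and> inj T \<and>
      (\<forall>x\<in>closure \<Omega>. 0 < \<alpha> x \<and> G x \<in> closure \<Omega> \<and> T (lift x) = \<alpha> x *\<^sub>R lift (G x)) \<and>
      \<alpha> m = 1 \<and> G m \<in> K \<and> G ` \<Omega> = \<Omega> \<and> (\<forall>x\<in>closure \<Omega> - \<Omega>. G x \<notin> \<Omega>)"
begin

text \<open>Each functional is recorded with the core point at which it is normalised, which makes
  the set compact.\<close>

definition functionals :: "((real^'n option) \<times> (real^'n)) set" where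
  "functionals = {(\<psi>, k). k \<in> K \<and> \<psi> \<bullet> lift k = 1 \<and> (\<forall>x\<in>\<Omega>. 0 \<le> \<psi> \<bullet> lift x)}"

lemma compact_closure_dom: "compact (closure \<Omega>)"
  using bounded_dom by (simp add: compact_closure)

lemma nonneg_on_closure:
  assumes "\<And>x. x \<in> \<Omega> \<Longrightarrow> 0 \<le> w \<bullet> lift x" "x \<in> closure \<Omega>"
  shows "0 \<le> w \<bullet> lift x"
proof (rule continuous_ge_on_closure[OF _ assms(2)])
  show "continuous_on (closure \<Omega>) (\<lambda>x. w \<bullet> lift x)"
    by (intro continuous_intros)
qed (rule assms(1))

lemma functional_nonneg:
  assumes "(\<psi>, k) \<in> functionals" "x \<in> closure \<Omega>"
  shows "0 \<le> \<psi> \<bullet> lift x"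
  by (rule nonneg_on_closure[OF _ assms(2)]) (use assms(1) in \<open>auto simp: functionals_def\<close>)

lemma core_ball: "\<exists>r>0. \<forall>k\<in>K. cball k r \<subseteq> \<Omega>"
proof -
  obtain r where "r > 0" "(\<Union>k\<in>K. cball k r) \<subseteq> \<Omega>"
    by (rule compact_subset_open_imp_cball_epsilon_subset[OF compact_core open_dom core_subset]) blast
  then show ?thesis by auto
qed

text \<open>If \<open>w\<close> vanished at a point of the open set, it would be negative slightly
  beyond that point on the line coming from \<open>z\<close>.\<close>

lemma functional_pos:
  fixes w :: "real^'n option"
  assumes nonneg: "\<And>x. x \<in> \<Omega> \<Longrightarrow> 0 \<le> w \<bullet> lift x" and z: "0 < w \<bullet> lift z" and x: "x \<in> \<Omega>"
  shows "0 < w \<bullet> lift x"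
proof (rule ccontr)
  assume "\<not> 0 < w \<bullet> lift x"
  with nonneg[OF x] have x0: "w \<bullet> lift x = 0" by simp
  have lim: "((\<lambda>e. x + e *\<^sub>R (x - z)) \<longlongrightarrow> x + 0 *\<^sub>R (x - z)) (at_right 0)"
    by (intro tendsto_intros)
  have "eventually (\<lambda>e. x + e *\<^sub>R (x - z) \<in> \<Omega>) (at_right 0)"
    using topological_tendstoD[OF lim open_dom] x by simp
  moreover have "eventually (\<lambda>e::real. e > 0) (at_right 0)"
    by (simp add: eventually_at_right_less)
  ultimately have "eventually (\<lambda>e. e > 0 \<and> x + e *\<^sub>R (x - z) \<in> \<Omega>) (at_right 0)"
    by (simp add: eventually_conj)
  then obtain e where e: "e > 0" "x + e *\<^sub>R (x - z) \<in> \<Omega>"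
    using eventually_happens[of _ "at_right (0::real)"] by auto
  have "lift (x + e *\<^sub>R (x - z)) = (1 + e) *\<^sub>R lift x + (- e) *\<^sub>R lift z"
    using lift_affine[of "1 + e" "- e" x z] by (simp add: algebra_simps)
  then have "w \<bullet> lift (x + e *\<^sub>R (x - z)) = - e * (w \<bullet> lift z)"
    using x0 by (simp add: inner_simps)
  then show False
    using nonneg[OF e(2)] e(1) z by (simp add: mult_le_0_iff)
qed

text \<open>Stepping from \<open>k\<close> by \<open>r\<close> against the gradient \<open>a\<close>
  stays in \<open>\<Omega>\<close> and lowers the value from 1 to \<open>1 - r * norm a\<close>,
  which must remain nonnegative. The normalisation at \<open>k\<close> then controls the constant
  term.\<close>

lemma functionals_bounded: "\<exists>B\<ge>1. \<forall>(\<psi>, k)\<in>functionals. norm \<psi> \<le> B"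
proof -
  obtain r where r: "r > 0" "\<And>k. k \<in> K \<Longrightarrow> cball k r \<subseteq> \<Omega>"
    using core_ball by auto
  obtain R where R: "\<And>k. k \<in> K \<Longrightarrow> norm k \<le> R"
    using compact_imp_bounded[OF compact_core] by (auto simp: bounded_iff)
  have "norm \<psi> \<le> max 1 (1 + 1 / r * R + 1 / r)" if F: "(\<psi>, k) \<in> functionals" for \<psi> k
  proof -
    define a where "a = (\<chi> j. \<psi> $ Some j)"
    have k: "k \<in> K" "\<psi> \<bullet> lift k = 1" and nonneg: "\<And>x. x \<in> \<Omega> \<Longrightarrow> 0 \<le> \<psi> \<bullet> lift x"
      using F by (auto simp: functionals_def)
    have eq: "\<psi> $ None = 1 - a \<bullet> k"
      using k(2) by (simp add: inner_lift a_def)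
    have a: "norm a \<le> 1 / r"
    proof -
      have "k - r *\<^sub>R sgn a \<in> cball k r"
        using r(1) by (simp add: dist_norm norm_sgn)
      then have "0 \<le> \<psi> \<bullet> lift (k - r *\<^sub>R sgn a)"
        using r(2)[OF k(1)] nonneg by blast
      also have "\<dots> = 1 - r * (a \<bullet> sgn a)"
        using eq by (simp add: inner_lift inner_simps flip: a_def)
      also have "a \<bullet> sgn a = norm a"
        by (cases "a = 0") (simp_all add: sgn_div_norm dot_square_norm power2_eq_square)
      finally show ?thesis
        using r(1) by (simp add: field_simps)
    qed
    have "\<bar>a \<bullet> k\<bar> \<le> norm a * norm k"
      by (rule Cauchy_Schwarz_ineq2)
    also have "\<dots> \<le> 1 / r * R"
      using a R[OF k(1)] r(1) by (intro mult_mono) auto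
    finally have "\<bar>\<psi> $ None\<bar> \<le> 1 + 1 / r * R"
      using eq by linarith
    then show ?thesis
      using norm_option_le[of \<psi>] a by (simp add: a_def)
  qed
  then show ?thesis
    by (intro exI[of _ "max 1 (1 + 1 / r * R + 1 / r)"]) auto
qed

lemma compact_functionals: "compact functionals"
proof -
  obtain B where B: "\<And>\<psi> k. (\<psi>, k) \<in> functionals \<Longrightarrow> norm \<psi> \<le> B"
    using functionals_bounded by blast
  have "functionals = (cball 0 B \<times> K) \<inter> {z. fst z \<bullet> lift (snd z) = 1}
      \<inter> (\<Inter>x\<in>\<Omega>. {z. 0 \<le> fst z \<bullet> lift x})"
    using B by (auto simp: functionals_def)
  also have "compact \<dots>"
    by (intro compact_Int_closed compact_Times compact_cball compact_core closed_INT ballI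
        closed_Collect_eq closed_Collect_le continuous_intros)
  finally show ?thesis .
qed

text \<open>Compactness: over all configurations with \<open>x\<close> and \<open>y\<close> at least
  \<open>\<epsilon>\<close> apart, the larger of the two values attains its minimum, and half of it
  serves as \<open>\<delta>\<close>. The minimum is positive: otherwise the whole segment would miss
  \<open>\<Omega>\<close> by \<open>functional_pos\<close> and lie in the frontier.\<close>

lemma uniform_strict_convexity:
  assumes "\<epsilon> > 0"
  shows "\<exists>\<delta>>0. \<forall>(\<psi>, k)\<in>functionals. \<forall>x\<in>closure \<Omega>. \<forall>y\<in>closure \<Omega>.
    \<psi> \<bullet> lift x \<le> \<delta> \<longrightarrow> \<psi> \<bullet> lift y \<le> \<delta> \<longrightarrow> norm (x - y) < \<epsilon>"
proof -
  define S where "S = (functionals \<times> closure \<Omega> \<times> closure \<Omega>) \<inter>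
    {z. \<epsilon> \<le> norm (fst (snd z) - snd (snd z))}"
  define f where "f z = max (fst (fst z) \<bullet> lift (fst (snd z))) (fst (fst z) \<bullet> lift (snd (snd z)))"
    for z :: "((real^'n option) \<times> (real^'n)) \<times> (real^'n) \<times> (real^'n)"
  have "compact S"
    unfolding S_def
    by (intro compact_Int_closed compact_Times compact_functionals compact_closure_dom
        closed_Collect_le continuous_intros)
  have cont: "continuous_on S f"
    unfolding f_def by (intro continuous_intros)
  have pos: "f z > 0" if "z \<in> S" for z
  proof (rule ccontr)
    obtain \<psi> k x y where z: "z = ((\<psi>, k), x, y)" by (metis prod.exhaust)
    assume "\<not> f z > 0"
    then have le: "\<psi> \<bullet> lift x \<le> 0" "\<psi> \<bullet> lift y \<le> 0"
      by (auto simp: f_def z)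
    from that have F: "(\<psi>, k) \<in> functionals" and xy: "x \<in> closure \<Omega>" "y \<in> closure \<Omega>" "\<epsilon> \<le> norm (x - y)"
      by (auto simp: S_def z)
    have "closed_segment x y \<subseteq> frontier \<Omega>"
    proof
      fix w assume w: "w \<in> closed_segment x y"
      then have cl: "w \<in> closure \<Omega>"
        using xy convex_dom by (meson closed_segment_subset convex_closure subsetD)
      obtain u where u: "0 \<le> u" "u \<le> 1" "w = (1 - u) *\<^sub>R x + u *\<^sub>R y"
        using w by (auto simp: in_segment)
      have "\<psi> \<bullet> lift w = (1 - u) * (\<psi> \<bullet> lift x) + u * (\<psi> \<bullet> lift y)"
        using u(3) by (simp add: lift_affine inner_simps)
      also have "\<dots> \<le> 0"
        using le u by (intro add_nonpos_nonpos mult_nonneg_nonpos) auto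
      finally have "w \<notin> \<Omega>"
        using functional_pos[of \<psi> k w] F by (auto simp: functionals_def)
      then show "w \<in> frontier \<Omega>"
        using cl open_dom by (simp add: frontier_def interior_open)
    qed
    then show False
      using no_segment[of x y] xy assms by (cases "x = y") auto
  qed
  show ?thesis
  proof (cases "S = {}")
    case True
    then have "norm (x - y) < \<epsilon>" if "(\<psi>, k) \<in> functionals" "x \<in> closure \<Omega>" "y \<in> closure \<Omega>" for \<psi> k x y
      using that by (force simp: S_def not_le)
    then show ?thesis by (intro exI[of _ 1]) auto
  next
    case False
    obtain z where z: "z \<in> S" "\<And>w. w \<in> S \<Longrightarrow> f z \<le> f w"
      using continuous_attains_inf[OF \<open>compact S\<close> False cont] by blast
    have "norm (x - y) < \<epsilon>" if "(\<psi>, k) \<in> functionals" "x \<in> closure \<Omega>" "y \<in> closure \<Omega>"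
      "\<psi> \<bullet> lift x \<le> f z / 2" "\<psi> \<bullet> lift y \<le> f z / 2" for \<psi> k x y
    proof (rule ccontr)
      assume "\<not> norm (x - y) < \<epsilon>"
      then have "((\<psi>, k), x, y) \<in> S"
        using that by (auto simp: S_def)
      then have "f z \<le> max (\<psi> \<bullet> lift x) (\<psi> \<bullet> lift y)"
        using z(2) by (force simp: f_def)
      then show False using that(4,5) pos[OF z(1)] by linarith
    qed
    then show ?thesis
      using pos[OF z(1)] by (intro exI[of _ "f z / 2"]) auto
  qed
qed


subsection \<open>Contraction of parallel chords\<close>

text \<open>The weighted endpoint need not have coordinate \<open>None\<close> equal to 1, so
  \<open>norm w\<close> is not the distance from \<open>k\<close> to \<open>q\<close>. That
  coordinate gives \<open>\<alpha> = 1 + w $ None\<close>; hence a small \<open>w\<close> changes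
  the weight little and forces \<open>q\<close> close to \<open>k\<close>, whereas a ball of uniform
  radius about \<open>k\<close> lies in \<open>\<Omega>\<close>.\<close>

lemma chord_through_core_long:
  "\<exists>c>0. \<forall>k\<in>K. \<forall>q\<in>closure \<Omega> - \<Omega>. \<forall>\<alpha> w.
    \<alpha> *\<^sub>R lift q = lift k + w \<longrightarrow> c \<le> norm w"
proof -
  obtain r where r: "r > 0" "\<And>k. k \<in> K \<Longrightarrow> cball k r \<subseteq> \<Omega>"
    using core_ball by auto
  obtain R where R: "R > 0" "\<And>q. q \<in> closure \<Omega> \<Longrightarrow> norm q \<le> R"
    using compact_imp_bounded[OF compact_closure_dom] by (auto simp: bounded_pos)
  have "r / (1 + (1 + R)) \<le> norm w"
    if k: "k \<in> K" and q: "q \<in> closure \<Omega> - \<Omega>" and eq: "\<alpha> *\<^sub>R lift q = lift k + w" for k q \<alpha> w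
  proof -
    have \<alpha>: "\<alpha> = 1 + w $ None"
      using arg_cong[OF eq, of "\<lambda>v. v $ None"] by simp
    have "lift q - lift k = w - (w $ None) *\<^sub>R lift q"
      using eq by (simp add: \<alpha> algebra_simps)
    then have "norm (q - k) = norm (w - (w $ None) *\<^sub>R lift q)"
      by (metis norm_lift_diff)
    also have "\<dots> \<le> norm w + \<bar>w $ None\<bar> * norm (lift q)"
      by (metis norm_scaleR norm_triangle_ineq4)
    also have "\<dots> \<le> norm w + norm w * (1 + R)"
      using component_le_norm_cart[of w None] norm_lift_le[of q] R(2)[of q] q
      by (intro add_mono mult_mono) auto
    finally have "norm (q - k) \<le> norm w * (1 + (1 + R))"
      by (simp add: algebra_simps)
    moreover have "q \<notin> cball k r"
      using r(2)[OF k] q by blast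
    then have "r < norm (q - k)"
      by (simp add: dist_norm norm_minus_commute)
    ultimately show ?thesis
      using R(1) by (simp add: field_simps)
  qed
  then show ?thesis
    using r(1) R(1) by (intro exI[of _ "r / (1 + (1 + R))"]) auto
qed

text \<open>The configuration of two parallel chords after the midpoint of the longer chord \<open>q r\<close> has
  been moved to \<open>k\<close> in the core. The functional \<open>\<psi>\<close> cuts out the supporting hyperplane at \<open>p\<close>,
  \<open>\<theta>\<close> cuts out the image of the original hyperplane at infinity, and \<open>\<rho>\<close> is the ratio of the
  original chord lengths. The point \<open>z\<close> (the old base point) keeps \<open>\<theta>\<close> away from zero at \<open>p\<close>:
  otherwise \<open>p\<close> and \<open>z\<close> would nearly coincide, although the segment between them crosses \<open>q r\<close>.
  The premises are ordered so that the first ones determine all variables by matching; other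
  orders make the unifier backtrack exponentially.\<close>

lemma normalized_contraction:
  obtains \<kappa> s0 :: real where "0 < \<kappa>" "\<kappa> \<le> 1/4" "0 < s0" "s0 \<le> 1"
    "\<And>k \<psi> \<theta> q r q' r' p z \<alpha> \<beta> \<alpha>' \<beta>' \<omega> \<pi> s u \<rho>.
      \<lbrakk>\<alpha>' *\<^sub>R lift q' - \<beta>' *\<^sub>R lift r' = \<rho> *\<^sub>R (\<alpha> *\<^sub>R lift q - \<beta> *\<^sub>R lift r);
       (1 - s) *\<^sub>R \<pi> *\<^sub>R lift p + s *\<^sub>R \<omega> *\<^sub>R lift z
         = (1 - u) *\<^sub>R \<alpha> *\<^sub>R lift q + u *\<^sub>R \<beta> *\<^sub>R lift r;
       \<alpha> *\<^sub>R lift q + \<beta> *\<^sub>R lift r = 2 *\<^sub>R lift k;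
       s * \<omega> * (\<psi> \<bullet> lift z) = 1; \<psi> \<bullet> lift p = 0;
       \<alpha>' * (\<psi> \<bullet> lift q') = \<kappa>; \<beta>' * (\<psi> \<bullet> lift r') = \<kappa>;
       \<omega> * (\<theta> \<bullet> lift z) = 1; \<alpha>' * (\<theta> \<bullet> lift q') = 1; \<beta>' * (\<theta> \<bullet> lift r') = 1;
       (\<psi>, k) \<in> functionals; (\<theta>, k) \<in> functionals;
       q \<in> closure \<Omega> - \<Omega>; q' \<in> closure \<Omega>; r' \<in> closure \<Omega>; p \<in> closure \<Omega>; z \<in> closure \<Omega>;
       0 < \<alpha>; 0 < \<beta>; 0 < \<alpha>'; 0 < \<beta>'; 0 < \<omega>; 0 < \<pi>;
       0 < s; s \<le> s0; 0 \<le> u; u \<le> 1; 0 \<le> \<rho>\<rbrakk>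
      \<Longrightarrow> \<rho> \<le> 1/2"
proof -
  obtain B where B: "B \<ge> 1" "\<And>\<psi> k. (\<psi>, k) \<in> functionals \<Longrightarrow> norm \<psi> \<le> B"
    using functionals_bounded by blast
  obtain R0 where R0: "R0 > 0" "\<And>x. x \<in> closure \<Omega> \<Longrightarrow> norm x \<le> R0"
    using compact_imp_bounded[OF compact_closure_dom] by (auto simp: bounded_pos)
  define R where "R = 1 + R0"
  have R: "R \<ge> 1" "\<And>x. x \<in> closure \<Omega> \<Longrightarrow> norm (lift x) \<le> R"
    using R0 by (auto simp: R_def intro: order_trans[OF norm_lift_le])
  define C where "C = B * R"
  have C: "C \<ge> 1" using B(1) R(1) unfolding C_def by (metis mult_mono mult_1 zero_le_one order_trans)
  have upper: "\<psi> \<bullet> lift x \<le> C" if "(\<psi>, k) \<in> functionals" "x \<in> closure \<Omega>" for \<psi> k x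
  proof -
    have "\<psi> \<bullet> lift x \<le> norm \<psi> * norm (lift x)" by (rule norm_cauchy_schwarz)
    also have "\<dots> \<le> C" unfolding C_def using B R that by (intro mult_mono) auto
    finally show ?thesis .
  qed
  have lip: "\<bar>\<psi> \<bullet> lift x - \<psi> \<bullet> lift y\<bar> \<le> B * norm (x - y)" if "(\<psi>, k) \<in> functionals" for \<psi> k x y
  proof -
    have "\<bar>\<psi> \<bullet> (lift x - lift y)\<bar> \<le> norm \<psi> * norm (lift x - lift y)" by (rule Cauchy_Schwarz_ineq2)
    also have "\<dots> \<le> B * norm (x - y)" using B(2)[OF that] by (simp add: norm_lift_diff mult_right_mono)
    finally show ?thesis by (simp add: inner_diff_right)
  qed
  obtain c where c: "c > 0"
    "\<And>k q \<alpha> w. k \<in> K \<Longrightarrow> q \<in> closure \<Omega> - \<Omega> \<Longrightarrow> \<alpha> *\<^sub>R lift q = lift k + w \<Longrightarrow> c \<le> norm w"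
    using chord_through_core_long by blast
  \<comment> \<open>Points closer than \<open>1 / (4 * B)\<close> have functional values differing
    by at most 1/4, which will rule out that \<open>z\<close> is close to \<open>p\<close>.\<close>
  obtain \<delta> where \<delta>: "\<delta> > 0" "\<And>\<psi> k x y. (\<psi>, k) \<in> functionals \<Longrightarrow> x \<in> closure \<Omega> \<Longrightarrow> y \<in> closure \<Omega> \<Longrightarrow>
      \<psi> \<bullet> lift x \<le> \<delta> \<Longrightarrow> \<psi> \<bullet> lift y \<le> \<delta> \<Longrightarrow> norm (x - y) < 1 / (4 * B)"
    using uniform_strict_convexity[of "1 / (4 * B)"] B(1) by fastforce
  \<comment> \<open>\<open>L * \<epsilon>\<close> will bound the transformed lower chord: the first
    term accounts for the displacement of its endpoints, the second for the difference of their
    weights. Both rely on \<open>\<theta>\<close> being at least \<open>\<delta> / 2\<close>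
    there.\<close>
  define L where "L = 2 / \<delta> + R * B * 4 / \<delta>\<^sup>2"
  have L: "L > 0" using \<delta>(1) R(1) B(1) by (simp add: L_def add_pos_pos)
  \<comment> \<open>The first entry keeps \<open>\<theta>\<close> at least
    \<open>\<delta> / 2\<close> within \<open>\<epsilon>\<close> of \<open>p\<close>; the second
    makes the lower chord no longer than \<open>c\<close>.\<close>
  define \<epsilon> where "\<epsilon> = min (\<delta> / (2 * B)) (c / L)"
  have \<epsilon>: "\<epsilon> > 0" "B * \<epsilon> \<le> \<delta> / 2" "L * \<epsilon> \<le> c"
    using \<delta>(1) B(1) c(1) L by (auto simp: \<epsilon>_def min_def field_simps)
  obtain \<delta>' where \<delta>': "\<delta>' > 0" "\<And>\<psi> k x y. (\<psi>, k) \<in> functionals \<Longrightarrow> x \<in> closure \<Omega> \<Longrightarrow> y \<in> closure \<Omega> \<Longrightarrow>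
      \<psi> \<bullet> lift x \<le> \<delta>' \<Longrightarrow> \<psi> \<bullet> lift y \<le> \<delta>' \<Longrightarrow> norm (x - y) < \<epsilon>"
    using uniform_strict_convexity[OF \<epsilon>(1)] by fastforce
  \<comment> \<open>On the endpoints of the lower chord \<open>\<psi>\<close> is
    \<open>\<kappa>\<close> times \<open>\<theta>\<close>, hence at most \<open>\<delta>'\<close>.
    Likewise \<open>s0\<close> makes \<open>\<theta>\<close> at most \<open>\<delta>\<close> at
    \<open>z\<close>, where it is \<open>s\<close> times \<open>\<psi>\<close>. The bound 1/4 will
    give a decay exponent of at most 1/2.\<close>
  define \<kappa> where "\<kappa> = min (1/4) (\<delta>' / C)"
  define s0 where "s0 = min 1 (\<delta> / C)"
  have \<kappa>: "0 < \<kappa>" "\<kappa> \<le> 1/4" "\<kappa> * C \<le> \<delta>'"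
    using \<delta>'(1) C by (auto simp: \<kappa>_def min_def field_simps)
  have s0: "0 < s0" "s0 \<le> 1" "s0 * C \<le> \<delta>"
    using \<delta>(1) C by (auto simp: s0_def min_def field_simps)
  show thesis
  proof (rule that[OF \<kappa>(1,2) s0(1,2)])
    fix k \<psi> \<theta> q r q' r' p z \<alpha> \<beta> \<alpha>' \<beta>' \<omega> \<pi> s u \<rho>
    assume par: "\<alpha>' *\<^sub>R lift q' - \<beta>' *\<^sub>R lift r' = \<rho> *\<^sub>R (\<alpha> *\<^sub>R lift q - \<beta> *\<^sub>R lift r)"
      and cross: "(1 - s) *\<^sub>R \<pi> *\<^sub>R lift p + s *\<^sub>R \<omega> *\<^sub>R lift z
        = (1 - u) *\<^sub>R \<alpha> *\<^sub>R lift q + u *\<^sub>R \<beta> *\<^sub>R lift r"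
      and mid: "\<alpha> *\<^sub>R lift q + \<beta> *\<^sub>R lift r = 2 *\<^sub>R lift k"
      and \<psi>: "s * \<omega> * (\<psi> \<bullet> lift z) = 1" "\<psi> \<bullet> lift p = 0"
        "\<alpha>' * (\<psi> \<bullet> lift q') = \<kappa>" "\<beta>' * (\<psi> \<bullet> lift r') = \<kappa>"
      and \<theta>: "\<omega> * (\<theta> \<bullet> lift z) = 1" "\<alpha>' * (\<theta> \<bullet> lift q') = 1" "\<beta>' * (\<theta> \<bullet> lift r') = 1"
      and F: "(\<psi>, k) \<in> functionals" "(\<theta>, k) \<in> functionals"
      and cl: "q \<in> closure \<Omega> - \<Omega>" "q' \<in> closure \<Omega>" "r' \<in> closure \<Omega>" "p \<in> closure \<Omega>" "z \<in> closure \<Omega>"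
      and pos: "0 < \<alpha>" "0 < \<beta>" "0 < \<alpha>'" "0 < \<beta>'" "0 < \<omega>" "0 < \<pi>"
      and su: "0 < s" "s \<le> s0" "0 \<le> u" "u \<le> 1" and \<rho>: "0 \<le> \<rho>"
    have sum2: "\<alpha> + \<beta> = 2"
      using arg_cong[OF mid, of "\<lambda>v. v $ None"] by simp
    \<comment> \<open>Coordinate \<open>None\<close> of the crossing relation: the right-hand side
      averages two positive weights with sum 2, which bounds the weight of \<open>z\<close>.\<close>
    have "(1 - s) * \<pi> + s * \<omega> = (1 - u) * \<alpha> + u * \<beta>"
      using arg_cong[OF cross, of "\<lambda>v. v $ None"] by simp
    also have "\<dots> \<le> (1 - u) * 2 + u * 2"
      using sum2 pos su by (intro add_mono mult_left_mono) auto
    finally have s\<omega>: "s * \<omega> \<le> 2"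
      using su s0 pos by (smt (verit) mult_nonneg_nonneg)
    have \<theta>z: "\<theta> \<bullet> lift z \<le> \<delta>"
    proof -
      have "\<theta> \<bullet> lift z = (s * \<omega> * (\<psi> \<bullet> lift z)) * (\<theta> \<bullet> lift z)"
        by (simp only: \<psi>(1) mult_1)
      also have "\<dots> = s * (\<omega> * (\<theta> \<bullet> lift z)) * (\<psi> \<bullet> lift z)"
        by (simp only: mult_ac)
      also have "\<dots> = s * (\<psi> \<bullet> lift z)" by (simp add: \<theta>)
      also have "\<dots> \<le> s0 * C"
        using su upper[OF F(1) cl(5)] functional_nonneg[OF F(1) cl(5)] s0 by (intro mult_mono) auto
      finally show ?thesis using s0 by simp
    qed
    have \<theta>p: "\<theta> \<bullet> lift p > \<delta>"
    proof (rule ccontr)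
      assume "\<not> \<theta> \<bullet> lift p > \<delta>"
      then have "norm (z - p) < 1 / (4 * B)"
        using \<delta>(2)[OF F(2) cl(5,4)] \<theta>z by simp
      then have "B * norm (z - p) \<le> 1 / 4"
        using B(1) by (simp add: field_simps)
      then have "\<psi> \<bullet> lift z \<le> 1 / 4"
        using lip[OF F(1), of z p] \<psi>(2) by simp
      then have "s * \<omega> * (\<psi> \<bullet> lift z) \<le> 2 * (1 / 4)"
        using s\<omega> su pos functional_nonneg[OF F(1) cl(5)] by (intro mult_mono) auto
      then show False using \<psi>(1) by simp
    qed
    \<comment> \<open>The weight \<open>a\<close> cancels in the ratio of \<open>\<psi>\<close> to
      \<open>\<theta>\<close>, which is therefore \<open>\<kappa>\<close>.\<close>
    have small: "\<psi> \<bullet> lift x \<le> \<delta>'" if "x \<in> closure \<Omega>" "a * (\<theta> \<bullet> lift x) = 1" "a * (\<psi> \<bullet> lift x) = \<kappa>" for a x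
    proof -
      have "\<psi> \<bullet> lift x = (a * (\<theta> \<bullet> lift x)) * (\<psi> \<bullet> lift x)"
        by (simp only: that mult_1)
      also have "\<dots> = (a * (\<psi> \<bullet> lift x)) * (\<theta> \<bullet> lift x)"
        by (simp only: mult_ac)
      also have "\<dots> = \<kappa> * (\<theta> \<bullet> lift x)"
        by (simp only: that)
      also have "\<dots> \<le> \<kappa> * C" using upper[OF F(2) that(1)] \<kappa> by (intro mult_left_mono) auto
      finally show ?thesis using \<kappa> by simp
    qed
    have near_p: "\<theta> \<bullet> lift x \<ge> \<delta> / 2" if "x \<in> closure \<Omega>" "\<psi> \<bullet> lift x \<le> \<delta>'" for x
    proof -
      have "norm (x - p) < \<epsilon>"
        using \<delta>'(2)[OF F(1) that(1) cl(4)] that(2) \<psi>(2) \<delta>'(1) by simp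
      then have "B * norm (x - p) \<le> \<delta> / 2"
        using \<epsilon>(2) B(1) by (smt (verit) mult_left_mono)
      then show ?thesis using lip[OF F(2), of x p] \<theta>p by simp
    qed
    define t1 t2 where "t1 = \<theta> \<bullet> lift q'" and "t2 = \<theta> \<bullet> lift r'"
    have t: "t1 \<ge> \<delta> / 2" "t2 \<ge> \<delta> / 2"
      using near_p small cl \<theta> \<psi> unfolding t1_def t2_def by blast+
    then have tpos: "t1 > 0" "t2 > 0" using \<delta>(1) by auto
    have \<alpha>\<beta>': "\<alpha>' = 1 / t1" "\<beta>' = 1 / t2"
      using \<theta> tpos by (auto simp: field_simps t1_def t2_def)
    have close: "norm (q' - r') < \<epsilon>"
      using \<delta>'(2)[OF F(1) cl(2,3)] small cl \<theta> \<psi> by blast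
    have "\<alpha>' *\<^sub>R lift q' - \<beta>' *\<^sub>R lift r'
        = (1 / t1) *\<^sub>R (lift q' - lift r') + ((t2 - t1) / (t1 * t2)) *\<^sub>R lift r'"
    proof -
      have eq: "(t2 - t1) / (t1 * t2) = 1 / t1 - 1 / t2" using tpos by (simp add: field_simps)
      show ?thesis unfolding eq \<alpha>\<beta>' by (simp add: algebra_simps)
    qed
    then have "norm (\<alpha>' *\<^sub>R lift q' - \<beta>' *\<^sub>R lift r')
        \<le> norm ((1 / t1) *\<^sub>R (lift q' - lift r')) + norm (((t2 - t1) / (t1 * t2)) *\<^sub>R lift r')"
      by (simp only: norm_triangle_ineq)
    also have "\<dots> = 1 / t1 * norm (q' - r') + \<bar>t2 - t1\<bar> / (t1 * t2) * norm (lift r')"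
      using tpos by (simp add: norm_lift_diff abs_mult)
    also have "\<dots> \<le> 2 / \<delta> * \<epsilon> + (B * \<epsilon>) / (\<delta> / 2 * (\<delta> / 2)) * R"
    proof (intro add_mono mult_mono)
      show "1 / t1 \<le> 2 / \<delta>" using t(1) \<delta>(1) tpos by (simp add: field_simps)
      have "\<bar>t2 - t1\<bar> \<le> B * norm (q' - r')"
        using lip[OF F(2), of q' r'] by (simp add: t1_def t2_def abs_minus_commute)
      also have "\<dots> \<le> B * \<epsilon>" using close B(1) by (intro mult_left_mono) auto
      finally show "\<bar>t2 - t1\<bar> / (t1 * t2) \<le> B * \<epsilon> / (\<delta> / 2 * (\<delta> / 2))"
        using t \<delta>(1) B(1) \<epsilon>(1) by (intro frac_le mult_mono) auto
    qed (use t \<delta>(1) tpos close \<epsilon> B R(2)[OF cl(3)] in auto)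
    also have "\<dots> = L * \<epsilon>"
      by (simp add: L_def field_simps power2_eq_square)
    finally have le: "norm (\<rho> *\<^sub>R (\<alpha> *\<^sub>R lift q - \<beta> *\<^sub>R lift r)) \<le> c"
      using \<epsilon>(3) par by simp
    \<comment> \<open>Half of the upper chord, that is, the vector from its midpoint
      \<open>lift k\<close> to its weighted end. Its norm is at least \<open>c\<close>, while
      \<open>\<rho>\<close> times the full chord has norm at most \<open>c\<close>.\<close>
    define w where "w = (1 / 2) *\<^sub>R (\<alpha> *\<^sub>R lift q - \<beta> *\<^sub>R lift r)"
    have "\<alpha> *\<^sub>R lift q = (1 / 2) *\<^sub>R (2 *\<^sub>R lift k) + w"
      unfolding w_def mid[symmetric] by (simp add: vec_eq_iff field_simps)
    then have "c \<le> norm w"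
      using c(2)[of k q \<alpha> w] cl(1) F(1) by (auto simp: functionals_def)
    moreover have "\<alpha> *\<^sub>R lift q - \<beta> *\<^sub>R lift r = 2 *\<^sub>R w"
      by (simp add: w_def)
    with le have "\<rho> * 2 * norm w \<le> c"
      using \<rho> by simp
    ultimately have "\<rho> * 2 * c \<le> c"
      using \<rho> c(1) by (smt (verit) mult_left_mono mult_nonneg_nonneg)
    then show "\<rho> \<le> 1/2" using c(1) by simp
  qed
qed

lemma contraction:
  obtains \<kappa> s0 :: real where "0 < \<kappa>" "\<kappa> \<le> 1/4" "0 < s0" "s0 \<le> 1"
    "\<And>\<phi> z p s a b. \<lbrakk>\<And>x. x \<in> \<Omega> \<Longrightarrow> 0 \<le> \<phi> \<bullet> lift x; z \<in> \<Omega>; p \<in> closure \<Omega>;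
       \<phi> \<bullet> lift z = 1; \<phi> \<bullet> lift p = 0; 0 < s; s \<le> s0; a \<in> closure \<Omega>; b \<in> closure \<Omega>;
       \<phi> \<bullet> lift a = \<kappa> * s; \<phi> \<bullet> lift b = \<kappa> * s\<rbrakk>
      \<Longrightarrow> \<exists>a'\<in>closure \<Omega>. \<exists>b'\<in>closure \<Omega>. \<phi> \<bullet> lift a' = s \<and> \<phi> \<bullet> lift b' = s \<and>
            norm (a - b) \<le> norm (a' - b') / 2"
proof (rule normalized_contraction, goal_cases)
  case (1 \<kappa> s0)
  note \<kappa> = 1(2,3) and s0 = 1(4,5) and contr = 1(6)
  show thesis
  proof (rule that[OF \<kappa> s0])
    fix \<phi> z p s a b
    assume \<phi>: "\<And>x. x \<in> \<Omega> \<Longrightarrow> 0 \<le> \<phi> \<bullet> lift x"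
      and z: "z \<in> \<Omega>" "\<phi> \<bullet> lift z = 1" and p: "p \<in> closure \<Omega>" "\<phi> \<bullet> lift p = 0"
      and s: "0 < s" "s \<le> s0" and ab: "a \<in> closure \<Omega>" "b \<in> closure \<Omega>"
      and \<phi>ab: "\<phi> \<bullet> lift a = \<kappa> * s" "\<phi> \<bullet> lift b = \<kappa> * s"
    have int: "interior \<Omega> = \<Omega>" using open_dom by (rule interior_open)
    define x where "x = (1 - s) *\<^sub>R p + s *\<^sub>R z"
    have "p - s *\<^sub>R (p - z) \<in> interior \<Omega>"
      using mem_interior_closure_convex_shrink[OF convex_dom, of z p s] z p s s0(2) int by simp
    then have x: "x \<in> \<Omega>"
      by (simp add: x_def int algebra_simps)
    have lift_x: "lift x = (1 - s) *\<^sub>R lift p + s *\<^sub>R lift z"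
      by (simp add: x_def lift_affine)
    have \<phi>x: "\<phi> \<bullet> lift x = s"
      using z p by (simp add: lift_x inner_simps)
    show "\<exists>a'\<in>closure \<Omega>. \<exists>b'\<in>closure \<Omega>. \<phi> \<bullet> lift a' = s \<and> \<phi> \<bullet> lift b' = s \<and>
            norm (a - b) \<le> norm (a' - b') / 2"
    proof (cases "a = b")
      case True
      then show ?thesis using x \<phi>x closure_subset by (intro bexI[of _ x]) auto
    next
      case False
      have lift_move: "lift (x + e *\<^sub>R (a - b)) = lift x + e *\<^sub>R (lift a - lift b)" for e
        by (auto simp: vec_eq_iff lift_def split: option.split)
      have \<phi>_move: "\<phi> \<bullet> lift (x + e *\<^sub>R (a - b)) = s" for e
        using \<phi>ab \<phi>x by (simp add: lift_move inner_simps)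
      obtain d where d: "0 < d" "x + d *\<^sub>R (a - b) \<in> frontier \<Omega>"
        "\<And>e. 0 \<le> e \<Longrightarrow> e < d \<Longrightarrow> x + e *\<^sub>R (a - b) \<in> \<Omega>"
        using ray_to_frontier[of \<Omega> x "a - b"] bounded_dom x False int by auto
      obtain d' where d': "0 < d'" "x + d' *\<^sub>R (b - a) \<in> frontier \<Omega>"
        "\<And>e. 0 \<le> e \<Longrightarrow> e < d' \<Longrightarrow> x + e *\<^sub>R (b - a) \<in> \<Omega>"
        using ray_to_frontier[of \<Omega> x "b - a"] bounded_dom x False int by auto
      define q where "q = x + d *\<^sub>R (a - b)"
      define r where "r = x + (- d') *\<^sub>R (a - b)"
      \<comment> \<open>The midpoint of the chord from \<open>q\<close> to \<open>r\<close>. Its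
        distance from \<open>x\<close> is less than the longer of the two arms, so it is still in
        \<open>\<Omega>\<close>.\<close>
      define m where "m = x + ((d - d') / 2) *\<^sub>R (a - b)"
      have front: "q \<in> closure \<Omega> - \<Omega>" "r \<in> closure \<Omega> - \<Omega>"
        using d(2) d'(2) int by (auto simp: frontier_def q_def r_def algebra_simps)
      have m: "m \<in> \<Omega>"
      proof (cases "d' \<le> d")
        case True
        then show ?thesis using d(1) d'(1) d(3)[of "(d - d') / 2"] by (simp add: m_def)
      next
        case False
        have "m = x + ((d' - d) / 2) *\<^sub>R (b - a)"
          by (simp add: m_def algebra_simps diff_divide_distrib)
        then show ?thesis using d(1) d'(1) d'(3)[of "(d' - d) / 2"] False by simp
      qed
      obtain T \<alpha> G where T: "linear T" "inj T"
        and G_all: "\<forall>y\<in>closure \<Omega>. 0 < \<alpha> y \<and> G y \<in> closure \<Omega> \<and> T (lift y) = \<alpha> y *\<^sub>R lift (G y)"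
        and Gm: "\<alpha> m = 1" "G m \<in> K" and G\<Omega>: "G ` \<Omega> = \<Omega>" "\<forall>y\<in>closure \<Omega> - \<Omega>. G y \<notin> \<Omega>"
        using move_to_core[OF m] by (elim exE conjE) (rule that)
      have G: "\<And>y. y \<in> closure \<Omega> \<Longrightarrow> 0 < \<alpha> y" "\<And>y. y \<in> closure \<Omega> \<Longrightarrow> G y \<in> closure \<Omega>"
          "\<And>y. y \<in> closure \<Omega> \<Longrightarrow> T (lift y) = \<alpha> y *\<^sub>R lift (G y)"
        using G_all by simp_all
      obtain S where S: "linear S" "S \<circ> T = id"
        using linear_injective_left_inverse[OF T] by blast
      define push where "push w = adjoint S w" for w
      have push: "push w \<bullet> T y = w \<bullet> y" for w y
        using adjoint_works[OF S(1), of "T y" w] pointfree_idE[OF S(2), of y]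
        by (simp add: push_def inner_commute)
      have push_G: "\<alpha> y * (push w \<bullet> lift (G y)) = w \<bullet> lift y" if "y \<in> closure \<Omega>" for w y
        using push[of w "lift y"] G(3)[OF that] by simp
      have sub: "y \<in> closure \<Omega>" if "y \<in> \<Omega>" for y using that closure_subset by blast
      have push_functional: "(push w, G m) \<in> functionals"
        if w: "w \<bullet> lift m = 1" "\<And>y. y \<in> \<Omega> \<Longrightarrow> 0 \<le> w \<bullet> lift y" for w
      proof -
        have "push w \<bullet> lift (G m) = 1"
          using push_G[OF sub[OF m], of w] w(1) Gm(1) by simp
        moreover have "0 \<le> push w \<bullet> lift y" if "y \<in> \<Omega>" for y
        proof -
          obtain y' where y': "y' \<in> \<Omega>" "y = G y'" using \<open>y \<in> \<Omega>\<close> G\<Omega>(1) by blast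
          have "0 \<le> \<alpha> y' * (push w \<bullet> lift y)"
            using push_G[OF sub[OF y'(1)], of w] w(2)[OF y'(1)] y'(2) by simp
          then show ?thesis using G(1)[OF sub[OF y'(1)]] by (simp add: zero_le_mult_iff)
        qed
        ultimately show ?thesis using Gm(2) by (simp add: functionals_def)
      qed
      \<comment> \<open>\<open>m\<close> has height \<open>s\<close>, so dividing by
        \<open>s\<close> gives value 1 there. The functional behind \<open>\<theta>\<close> is the
        constant 1 on the chart.\<close>
      define \<psi> where "\<psi> = push ((1 / s) *\<^sub>R \<phi>)"
      define \<theta> where "\<theta> = push (axis None 1)"
      have axis: "axis None 1 \<bullet> lift y = 1" for y :: "real^'n"
        by (simp add: inner_axis')
      have F: "(\<psi>, G m) \<in> functionals" "(\<theta>, G m) \<in> functionals"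
        unfolding \<psi>_def \<theta>_def using \<phi> \<phi>_move s axis
        by (intro push_functional; simp add: m_def)+
      have \<psi>: "\<alpha> y * (\<psi> \<bullet> lift (G y)) = (\<phi> \<bullet> lift y) / s"
        and \<theta>: "\<alpha> y * (\<theta> \<bullet> lift (G y)) = 1" if "y \<in> closure \<Omega>" for y
        using push_G[OF that] axis by (simp_all add: \<psi>_def \<theta>_def)
      \<comment> \<open>\<open>u\<close> locates \<open>x\<close> between \<open>q\<close> and
        \<open>r\<close>; \<open>\<rho>\<close> is the ratio of the chords because
        \<open>q - r = (d + d') *\<^sub>R (a - b)\<close>.\<close>
      define u where "u = d / (d + d')"
      define \<rho> where "\<rho> = 1 / (d + d')"
      note lin = linear_add[OF T(1)] linear_diff[OF T(1)] linear_scale[OF T(1)]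
      have Tq: "\<alpha> q *\<^sub>R lift (G q) = T (lift q)" and Tr: "\<alpha> r *\<^sub>R lift (G r) = T (lift r)"
        using G(3) front by auto
      have "\<rho> \<le> 1/2"
      proof (rule contr[where k = "G m" and \<psi> = \<psi> and \<theta> = \<theta> and q = "G q" and r = "G r" and q' = "G a" and r' = "G b" and p = "G p"
            and z = "G z" and \<alpha> = "\<alpha> q" and \<beta> = "\<alpha> r" and \<alpha>' = "\<alpha> a" and \<beta>' = "\<alpha> b"
            and \<omega> = "\<alpha> z" and \<pi> = "\<alpha> p" and s = s and u = u])
        show "G q \<in> closure \<Omega> - \<Omega>" using front G(2) G\<Omega>(2) by blast
        show "\<psi> \<bullet> lift (G p) = 0" using \<psi>[OF p(1)] p(2) G(1)[OF p(1)] by simp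
        show "s * \<alpha> z * (\<psi> \<bullet> lift (G z)) = 1" using \<psi>[OF sub[OF z(1)]] z(2) s by (simp add: field_simps)
        show "\<alpha> q *\<^sub>R lift (G q) + \<alpha> r *\<^sub>R lift (G r) = 2 *\<^sub>R lift (G m)"
        proof -
          have "lift q + lift r = 2 *\<^sub>R lift m"
            unfolding q_def r_def m_def lift_move by (simp add: vec_eq_iff field_simps)
          moreover have "T (lift m) = lift (G m)" using G(3)[OF sub[OF m]] Gm(1) by simp
          ultimately show ?thesis by (metis Tq Tr lin(1,3))
        qed
        have "lift x = (1 - u) *\<^sub>R lift q + u *\<^sub>R lift r"
        proof -
          have "(1 - u) * d = u * d'" using d(1) d'(1) by (simp add: u_def field_simps)
          moreover have "(1 - u) *\<^sub>R lift q + u *\<^sub>R lift r = lift x + ((1 - u) * d - u * d') *\<^sub>R (lift a - lift b)"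
            unfolding q_def r_def lift_move by (simp add: vec_eq_iff algebra_simps)
          ultimately show ?thesis by simp
        qed
        then have "T (lift x) = (1 - u) *\<^sub>R T (lift q) + u *\<^sub>R T (lift r)"
          by (simp add: lin)
        moreover have "T (lift x) = (1 - s) *\<^sub>R \<alpha> p *\<^sub>R lift (G p) + s *\<^sub>R \<alpha> z *\<^sub>R lift (G z)"
          using G(3)[OF p(1)] G(3)[OF sub[OF z(1)]] by (simp add: lift_x lin)
        ultimately show "(1 - s) *\<^sub>R \<alpha> p *\<^sub>R lift (G p) + s *\<^sub>R \<alpha> z *\<^sub>R lift (G z)
            = (1 - u) *\<^sub>R \<alpha> q *\<^sub>R lift (G q) + u *\<^sub>R \<alpha> r *\<^sub>R lift (G r)"
          by (simp only: Tq Tr)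
        have "lift q - lift r = (d + d') *\<^sub>R (lift a - lift b)"
          unfolding q_def r_def lift_move by (simp add: vec_eq_iff algebra_simps)
        then have "lift a - lift b = \<rho> *\<^sub>R (lift q - lift r)"
          using d(1) d'(1) by (simp add: \<rho>_def)
        then have "T (lift a) - T (lift b) = \<rho> *\<^sub>R (T (lift q) - T (lift r))"
          by (metis lin(2,3))
        then show "\<alpha> a *\<^sub>R lift (G a) - \<alpha> b *\<^sub>R lift (G b)
            = \<rho> *\<^sub>R (\<alpha> q *\<^sub>R lift (G q) - \<alpha> r *\<^sub>R lift (G r))"
          using G(3)[OF ab(1)] G(3)[OF ab(2)] Tq Tr by simp
      qed (use F G ab p z(1) sub front s d(1) d'(1) \<psi> \<theta> \<phi>ab in \<open>auto simp: u_def \<rho>_def\<close>)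
      moreover have "a - b = \<rho> *\<^sub>R (q - r)"
      proof -
        have "q - r = (d + d') *\<^sub>R (a - b)" by (simp add: q_def r_def algebra_simps)
        then show ?thesis using d(1) d'(1) by (simp add: \<rho>_def)
      qed
      then have "norm (a - b) = \<rho> * norm (q - r)"
        using d(1) d'(1) by (simp add: \<rho>_def)
      ultimately have "norm (a - b) \<le> norm (q - r) / 2"
        using mult_right_mono[of \<rho> "1/2" "norm (q - r)"] by simp
      moreover have "\<phi> \<bullet> lift q = s" "\<phi> \<bullet> lift r = s"
        by (simp_all only: q_def r_def \<phi>_move)
      ultimately show ?thesis using front by blast
    qed
  qed
qed

section \<open>Power-law decay of sections and caps\<close>

text \<open>Iterates the contraction: each factor \<open>\<kappa>\<close> in the height halves the
  bound on the length, so the exponent solves \<open>\<kappa> powr \<gamma> = 1/2\<close>. From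
  \<open>\<kappa> \<le> 1/4\<close> it is at most 1/2.\<close>

lemma section_diameter:
  obtains \<gamma> C :: real where "0 < \<gamma>" "\<gamma> \<le> 1/2" "0 < C"
    "\<And>\<phi> z p t a b. \<lbrakk>\<And>x. x \<in> \<Omega> \<Longrightarrow> 0 \<le> \<phi> \<bullet> lift x; z \<in> \<Omega>; p \<in> closure \<Omega>;
       \<phi> \<bullet> lift z = 1; \<phi> \<bullet> lift p = 0; 0 < t; a \<in> closure \<Omega>; b \<in> closure \<Omega>;
       \<phi> \<bullet> lift a = t; \<phi> \<bullet> lift b = t\<rbrakk> \<Longrightarrow> norm (a - b) \<le> C * t powr \<gamma>"
proof (rule contraction, goal_cases)
  case (1 \<kappa> s0)
  note \<kappa> = 1(2,3) and s0 = 1(4,5) and contr = 1(6)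
  obtain R where R: "R > 0" "\<And>x. x \<in> closure \<Omega> \<Longrightarrow> norm x \<le> R"
    using compact_imp_bounded[OF compact_closure_dom] by (auto simp: bounded_pos)
  define \<gamma> where "\<gamma> = ln 2 / ln (1 / \<kappa>)"
  have ln4: "ln (1 / \<kappa>) \<ge> 2 * ln 2"
  proof -
    have "ln (2 ^ 2) \<le> ln (1 / \<kappa>)"
      using \<kappa> by (subst ln_le_cancel_iff) (auto simp: field_simps)
    then show ?thesis by (simp only: ln_realpow of_nat_numeral)
  qed
  then have lnpos: "ln (1 / \<kappa>) > 0" using ln_gt_zero[of "2::real"] by linarith
  have \<gamma>: "0 < \<gamma>" "\<gamma> \<le> 1/2"
    using ln4 lnpos by (auto simp: \<gamma>_def field_simps)
  have half: "\<kappa> powr \<gamma> = 1/2"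
  proof -
    have "\<gamma> * ln \<kappa> = - ln 2"
      using lnpos \<kappa> by (simp add: \<gamma>_def ln_div)
    then show ?thesis using \<kappa> by (simp add: powr_def exp_minus)
  qed
  \<comment> \<open>For heights of at least \<open>\<kappa> * s0\<close> the trivial bound
    \<open>2 * R\<close> suffices; \<open>C\<close> absorbs it.\<close>
  define C where "C = 2 * R / (\<kappa> * s0) powr \<gamma>"
  have C: "C > 0" using R \<kappa> s0 by (simp add: C_def)
  show thesis
  proof (rule that[OF \<gamma> C])
    fix \<phi> z p t a b
    assume \<phi>: "\<And>x. x \<in> \<Omega> \<Longrightarrow> 0 \<le> \<phi> \<bullet> lift x"
      and zp: "z \<in> \<Omega>" "p \<in> closure \<Omega>" "\<phi> \<bullet> lift z = 1" "\<phi> \<bullet> lift p = 0"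
      and t: "0 < t" and ab: "a \<in> closure \<Omega>" "b \<in> closure \<Omega>" "\<phi> \<bullet> lift a = t" "\<phi> \<bullet> lift b = t"
    \<comment> \<open>Induction on the number of contractions that may be required, for all chords
      at once, since each step passes to another chord at height
      \<open>t / \<kappa>\<close>.\<close>
    have *: "norm (a - b) \<le> C * t powr \<gamma>"
      if "\<kappa> ^ n * s0 \<le> t" "0 < t" "a \<in> closure \<Omega>" "b \<in> closure \<Omega>" "\<phi> \<bullet> lift a = t" "\<phi> \<bullet> lift b = t" for n t a b
      using that
    proof (induction n arbitrary: t a b)
      case (Suc n)
      show ?case
      proof (cases "t \<ge> \<kappa> * s0")
        case True
        have "norm (a - b) \<le> norm a + norm b" by (rule norm_triangle_ineq4)
        also have "\<dots> \<le> C * (\<kappa> * s0) powr \<gamma>"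
          using R(2)[OF Suc.prems(3)] R(2)[OF Suc.prems(4)] \<kappa> s0 by (simp add: C_def)
        also have "\<dots> \<le> C * t powr \<gamma>"
          using C True \<gamma> \<kappa> s0 by (intro mult_left_mono powr_mono2) auto
        finally show ?thesis .
      next
        case False
        have s: "0 < t / \<kappa>" "t / \<kappa> \<le> s0" "t = \<kappa> * (t / \<kappa>)"
          using False \<kappa> Suc.prems(2) by (auto simp: field_simps)
        obtain a' b' where a'b': "a' \<in> closure \<Omega>" "b' \<in> closure \<Omega>" "\<phi> \<bullet> lift a' = t / \<kappa>" "\<phi> \<bullet> lift b' = t / \<kappa>"
          "norm (a - b) \<le> norm (a' - b') / 2"
          using contr[OF \<phi> zp s(1,2) Suc.prems(3,4)] Suc.prems(5,6) s(3) by auto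
        have "norm (a - b) \<le> norm (a' - b') / 2" by fact
        also have "\<dots> \<le> C * (t / \<kappa>) powr \<gamma> / 2"
          using Suc.IH[of "t / \<kappa>" a' b'] a'b' s(1) Suc.prems(1) \<kappa> by (simp add: field_simps)
        also have "\<dots> = C * t powr \<gamma>"
          using \<kappa> Suc.prems(2) half by (simp add: powr_divide)
        finally show ?thesis .
      qed
    next
      case 0
      have "norm (a - b) \<le> norm a + norm b" by (rule norm_triangle_ineq4)
      also have "\<dots> \<le> C * (\<kappa> * s0) powr \<gamma>"
        using R(2)[OF 0(3)] R(2)[OF 0(4)] \<kappa> s0 by (simp add: C_def)
      also have "\<dots> \<le> C * t powr \<gamma>"
      proof (intro mult_left_mono powr_mono2)
        have "\<kappa> * s0 \<le> 1 * s0" using \<kappa> s0 by (intro mult_right_mono) auto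
        then show "\<kappa> * s0 \<le> t" using 0(1) by simp
      qed (use C \<gamma> \<kappa> s0 in auto)
      finally show ?case .
    qed
    have "\<exists>n. \<kappa> ^ n < t / s0"
      using \<kappa> t s0 by (intro real_arch_pow_inv) auto
    then obtain n where "\<kappa> ^ n < t / s0" ..
    then have "\<kappa> ^ n * s0 \<le> t" using s0 by (simp add: field_simps)
    then show "norm (a - b) \<le> C * t powr \<gamma>"
      using * t ab by blast
  qed
qed

text \<open>Points of the cap are raised to height exactly \<open>t\<close> by moving them towards
  \<open>z\<close>. The displacement is of order \<open>t\<close>, which
  \<open>t powr \<gamma>\<close> dominates for \<open>t < 1\<close>.\<close>

lemma cap_diameter:
  obtains \<gamma> C :: real where "0 < \<gamma>" "\<gamma> \<le> 1/2" "0 < C"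
    "\<And>\<phi> z p t a b. \<lbrakk>\<And>x. x \<in> \<Omega> \<Longrightarrow> 0 \<le> \<phi> \<bullet> lift x; z \<in> \<Omega>; p \<in> closure \<Omega>;
       \<phi> \<bullet> lift z = 1; \<phi> \<bullet> lift p = 0; 0 < t; t < 1; a \<in> closure \<Omega>; b \<in> closure \<Omega>;
       \<phi> \<bullet> lift a \<le> t; \<phi> \<bullet> lift b \<le> t\<rbrakk> \<Longrightarrow> norm (a - b) \<le> C * t powr \<gamma>"
proof (rule section_diameter, goal_cases)
  case (1 \<gamma> C)
  note \<gamma> = 1(2,3) and C = 1(4) and sec = 1(5)
  obtain R where R: "R > 0" "\<And>x. x \<in> closure \<Omega> \<Longrightarrow> norm x \<le> R"
    using compact_imp_bounded[OF compact_closure_dom] by (auto simp: bounded_pos)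
  have C': "0 < C + 4 * R" using C R by simp
  show thesis
  proof (rule that[OF \<gamma> C'])
    fix \<phi> z p t a b
    assume \<phi>: "\<And>x. x \<in> \<Omega> \<Longrightarrow> 0 \<le> \<phi> \<bullet> lift x"
      and zp: "z \<in> \<Omega>" "p \<in> closure \<Omega>" "\<phi> \<bullet> lift z = 1" "\<phi> \<bullet> lift p = 0"
      and t: "0 < t" "t < 1" and ab: "a \<in> closure \<Omega>" "b \<in> closure \<Omega>"
      "\<phi> \<bullet> lift a \<le> t" "\<phi> \<bullet> lift b \<le> t"
    have raise: "\<exists>x'\<in>closure \<Omega>. \<phi> \<bullet> lift x' = t \<and> norm (x' - x) \<le> 2 * R * t"
      if x: "x \<in> closure \<Omega>" "\<phi> \<bullet> lift x \<le> t" for x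
    proof -
      define h where "h = \<phi> \<bullet> lift x"
      have h: "0 \<le> h" "h \<le> t"
      proof -
        show "0 \<le> h" unfolding h_def using \<phi> x(1) by (rule nonneg_on_closure)
        show "h \<le> t" using x by (simp add: h_def)
      qed
      \<comment> \<open>Solves \<open>(1 - e) * h + e = t\<close>, the height of \<open>z\<close>
        being 1.\<close>
      define e where "e = (t - h) / (1 - h)"
      have "h * t \<le> h * 1" using h t by (intro mult_left_mono) auto
      then have e: "0 \<le> e" "e \<le> t" "e * (1 - h) = t - h"
        using h t by (auto simp: e_def field_simps)
      define x' where "x' = (1 - e) *\<^sub>R x + e *\<^sub>R z"
      have "x' \<in> closure \<Omega>"
        unfolding x'_def using convex_closure[OF convex_dom] x(1) zp(1) closure_subset[of \<Omega>] e t
        by (intro convexD) auto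
      moreover have "\<phi> \<bullet> lift x' = (1 - e) * h + e"
        by (simp add: x'_def lift_affine inner_simps zp h_def)
      then have "\<phi> \<bullet> lift x' = t" using e(3) by (simp add: algebra_simps)
      moreover have "norm (x' - x) \<le> 2 * R * t"
      proof -
        have "x' - x = e *\<^sub>R (z - x)" by (simp add: x'_def algebra_simps)
        then have "norm (x' - x) = e * norm (z - x)" using e by simp
        also have "\<dots> \<le> t * (norm z + norm x)"
          using e t norm_triangle_ineq4[of z x] by (intro mult_mono) auto
        also have "\<dots> \<le> t * (2 * R)"
          using R(2)[OF x(1)] R(2)[of z] zp(1) closure_subset[of \<Omega>] t by (intro mult_left_mono) auto
        finally show ?thesis by (simp add: algebra_simps)
      qed
      ultimately show ?thesis by blast
    qed
    obtain a' b' where a': "a' \<in> closure \<Omega>" "\<phi> \<bullet> lift a' = t" "norm (a' - a) \<le> 2 * R * t"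
      and b': "b' \<in> closure \<Omega>" "\<phi> \<bullet> lift b' = t" "norm (b' - b) \<le> 2 * R * t"
      using raise ab by metis
    have "norm (a - b) \<le> norm (a' - b') + norm (a' - a) + norm (b' - b)"
      by norm
    also have "\<dots> \<le> C * t powr \<gamma> + 4 * R * t"
      using sec[OF \<phi> zp t(1) a'(1) b'(1) a'(2) b'(2)] a'(3) b'(3) by simp
    also have "\<dots> \<le> C * t powr \<gamma> + 4 * R * t powr \<gamma>"
    proof -
      have "t powr 1 \<le> t powr \<gamma>" using t \<gamma> by (intro powr_mono') auto
      then show ?thesis using t R by simp
    qed
    finally show "norm (a - b) \<le> (C + 4 * R) * t powr \<gamma>"
      by (simp add: algebra_simps)
  qed
qed

subsection \<open>The Minkowski functional\<close>

lemma supporting_functional: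
  assumes p: "p \<in> frontier \<Omega>" and z: "z \<in> \<Omega>"
  shows "\<exists>\<phi>. (\<forall>x\<in>\<Omega>. 0 \<le> \<phi> \<bullet> lift x) \<and> \<phi> \<bullet> lift z = 1 \<and> \<phi> \<bullet> lift p = 0"
proof -
  have "p \<notin> \<Omega>" using p open_dom by (simp add: frontier_def interior_open)
  then obtain a b where ab: "a \<noteq> 0" "a \<bullet> p \<le> b" "\<And>x. x \<in> \<Omega> \<Longrightarrow> b \<le> a \<bullet> x"
    using separating_hyperplane_sets[of "{p}" \<Omega>] convex_dom z by auto
  \<comment> \<open>The constant term uses \<open>a \<bullet> p\<close> rather than
    \<open>b\<close>, so that \<open>w\<close> vanishes at \<open>p\<close>; nonnegativity survives
    because \<open>a \<bullet> p \<le> b\<close>.\<close>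
  define w :: "real^'n option" where "w = (\<chi> i. case i of None \<Rightarrow> - (a \<bullet> p) | Some j \<Rightarrow> a $ j)"
  have w: "w \<bullet> lift x = a \<bullet> x - a \<bullet> p" for x
    by (simp add: inner_lift w_def)
  have nonneg: "0 \<le> w \<bullet> lift x" if "x \<in> \<Omega>" for x
    using ab(2) ab(3)[OF that] by (simp add: w)
  \<comment> \<open>Any point of the space with a positive value, inside \<open>\<Omega>\<close> or
    not, lets \<open>functional_pos\<close> yield positivity at \<open>z\<close>.\<close>
  moreover have "0 < w \<bullet> lift (p + a)"
    using ab(1) by (simp add: w inner_simps)
  ultimately have pos: "0 < w \<bullet> lift z"
    using functional_pos z by blast
  show ?thesis
    using nonneg pos w[of p] by (intro exI[of _ "(1 / (w \<bullet> lift z)) *\<^sub>R w"]) simp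
qed

lemma minkowski_zero: "x \<in> \<Omega> \<Longrightarrow> minkowski \<Omega> x 0 = 0"
  by (simp add: minkowski_def flip: greaterThan_def)

text \<open>The ray leaves \<open>\<Omega>\<close> at parameter \<open>d\<close> and never returns,
  so the admissible \<open>a\<close> form the open half-line above \<open>1 / d\<close>. A return
  would put the frontier point between two points of the convex open set.\<close>

lemma minkowski_eq_inverse:
  assumes x: "x \<in> \<Omega>" and "v \<noteq> 0"
  obtains d where "0 < d" "x + d *\<^sub>R v \<in> frontier \<Omega>" "minkowski \<Omega> x v = 1 / d"
proof -
  obtain d where d: "0 < d" "x + d *\<^sub>R v \<in> frontier \<Omega>"
    "\<And>e. 0 \<le> e \<Longrightarrow> e < d \<Longrightarrow> x + e *\<^sub>R v \<in> \<Omega>"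
    using ray_to_frontier[of \<Omega> x v] bounded_dom assms interior_open[OF open_dom] by auto
  have "{a. a > 0 \<and> x + (1 / a) *\<^sub>R v \<in> \<Omega>} = {1 / d<..}"
  proof (intro subset_antisym subsetI)
    fix a assume "a \<in> {a. a > 0 \<and> x + (1 / a) *\<^sub>R v \<in> \<Omega>}"
    then have a: "a > 0" "x + (1 / a) *\<^sub>R v \<in> \<Omega>" by auto
    show "a \<in> {1 / d<..}"
    proof (rule ccontr)
      assume "a \<notin> {1 / d<..}"
      then have "d * a \<le> 1" using d(1) by (simp add: field_simps)
      then have "(1 - d * a) *\<^sub>R x + (d * a) *\<^sub>R (x + (1 / a) *\<^sub>R v) \<in> \<Omega>"
        using convex_dom x a d(1) by (intro convexD) auto
      moreover have "(1 - d * a) *\<^sub>R x + (d * a) *\<^sub>R (x + (1 / a) *\<^sub>R v) = x + d *\<^sub>R v"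
        using a(1) by (simp add: algebra_simps)
      ultimately show False
        using d(2) open_dom by (simp add: frontier_def interior_open)
    qed
  next
    fix a assume "a \<in> {1 / d<..}"
    then have "1 / d < a" by simp
    moreover from this have "a > 0" using d(1) by (meson divide_pos_pos less_trans zero_less_one)
    ultimately show "a \<in> {a. a > 0 \<and> x + (1 / a) *\<^sub>R v \<in> \<Omega>}"
      using d(1) d(3)[of "1 / a"] by (simp add: field_simps)
  qed
  then have "minkowski \<Omega> x v = 1 / d"
    by (simp add: minkowski_def)
  with d that show thesis by blast
qed

lemma minkowski_le_one_imp:
  assumes x: "x \<in> \<Omega>" and "minkowski \<Omega> x v \<le> 1"
  shows "x + v \<in> closure \<Omega>"
proof (cases "v = 0")
  case True
  then show ?thesis using x closure_subset by auto
next
  case False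
  obtain d where d: "0 < d" "x + d *\<^sub>R v \<in> frontier \<Omega>" "minkowski \<Omega> x v = 1 / d"
    using minkowski_eq_inverse[OF x False] .
  have "1 / d \<le> 1" using d(3) assms(2) by simp
  then have "(1 - 1 / d) *\<^sub>R x + (1 / d) *\<^sub>R (x + d *\<^sub>R v) \<in> closure \<Omega>"
    using convex_closure[OF convex_dom] x closure_subset[of \<Omega>] d(1,2)
    by (intro convexD) (auto simp: frontier_def)
  then show ?thesis using d(1) by (simp add: algebra_simps)
qed

text \<open>Turns separation measured by the functional into Euclidean separation, as the cap
  estimate requires.\<close>

lemma minkowski_le_norm:
  assumes r: "r > 0" "cball x r \<subseteq> \<Omega>"
  shows "minkowski \<Omega> x v \<le> norm v / r"
proof (cases "v = 0")
  case True
  have "x \<in> \<Omega>" using r by auto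
  with True show ?thesis by (simp add: minkowski_zero)
next
  case False
  have "x + (1 / (norm v / r)) *\<^sub>R v \<in> cball x r"
    using r(1) False by (simp add: dist_norm)
  then show ?thesis
    unfolding minkowski_def using r False
    by (intro cInf_lower bdd_belowI[of _ 0]) auto
qed

lemma minkowski_uniformly_convex:
  assumes x0: "x0 \<in> \<Omega>"
  shows "\<exists>\<beta> C. \<beta> \<ge> 2 \<and> C > 0 \<and>
     (\<forall>\<epsilon>\<in>{0..2}. modulus_of_convexity (minkowski \<Omega> x0) \<epsilon> \<ge> ereal (C * \<epsilon> powr \<beta>))"
proof (rule cap_diameter, goal_cases)
  case (1 \<gamma> C)
  note \<gamma> = 1(1,2) and C = 1(3) and cap = 1(4)
  let ?N = "minkowski \<Omega> x0"
  obtain r where r: "r > 0" "cball x0 r \<subseteq> \<Omega>"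
    using open_dom x0 open_contains_cball by blast
  define \<beta> where "\<beta> = 1 / \<gamma>"
  have \<beta>: "\<beta> \<ge> 2" using \<gamma> by (simp add: \<beta>_def field_simps)
  \<comment> \<open>The first entry comes from the cap estimate. The second makes the claimed bound
    at most 1/2 for \<open>\<epsilon> \<le> 2\<close>, which settles midpoints of height at least
    1/2.\<close>
  define c where "c = min ((r / C) powr \<beta> / 2) (1 / 2 / 2 powr \<beta>)"
  have c: "c > 0" using r C by (simp add: c_def)
  have "c * \<epsilon> powr \<beta> \<le> 1 - ?N (x + y) / 2"
    if \<epsilon>: "0 \<le> \<epsilon>" "\<epsilon> \<le> 2" and xy: "?N x \<le> 1" "?N y \<le> 1" "\<epsilon> \<le> ?N (x - y)" for \<epsilon> x y
  proof -
    have "c * \<epsilon> powr \<beta> \<le> (1 / 2 / 2 powr \<beta>) * 2 powr \<beta>"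
      using \<epsilon> \<beta> c by (intro mult_mono powr_mono2) (auto simp: c_def)
    then have half: "c * \<epsilon> powr \<beta> \<le> 1 / 2" by simp
    show ?thesis
    proof (cases "x + y = 0")
      case True
      then show ?thesis using half minkowski_zero[OF x0] by simp
    next
      case False
      obtain d where d: "0 < d" "x0 + d *\<^sub>R (x + y) \<in> frontier \<Omega>" "?N (x + y) = 1 / d"
        using minkowski_eq_inverse[OF x0 False] .
      define p where "p = x0 + d *\<^sub>R (x + y)"
      have p: "p \<in> closure \<Omega>" using d(2) by (simp add: p_def frontier_def)
      obtain \<phi> where \<phi>: "\<And>x. x \<in> \<Omega> \<Longrightarrow> 0 \<le> \<phi> \<bullet> lift x" "\<phi> \<bullet> lift x0 = 1" "\<phi> \<bullet> lift p = 0"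
        using supporting_functional[OF d(2) x0] unfolding p_def by blast
      define f where "f = (\<chi> j. \<phi> $ Some j)"
      have move: "\<phi> \<bullet> lift (x0 + v) = 1 + f \<bullet> v" for v
        using \<phi>(2) by (simp add: inner_lift f_def inner_simps)
      have cl: "x0 + x \<in> closure \<Omega>" "x0 + y \<in> closure \<Omega>"
        using minkowski_le_one_imp[OF x0] xy by auto
      have nonneg: "0 \<le> \<phi> \<bullet> lift w" if "w \<in> closure \<Omega>" for w
        using \<phi>(1) that by (rule nonneg_on_closure)
      \<comment> \<open>The height of the midpoint \<open>x0 + (x + y) / 2\<close>: along
        \<open>x + y\<close> the height drops from 1 at \<open>x0\<close> to 0 at parameter
        \<open>d\<close>.\<close>
      define t where "t = 1 - ?N (x + y) / 2"
      have "d * (f \<bullet> (x + y)) = - 1"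
        using \<phi>(3) move[of "d *\<^sub>R (x + y)"] by (simp add: p_def)
      then have sum: "f \<bullet> (x + y) = - (1 / d)"
        using d(1) by (simp add: field_simps)
      then have sum_t: "\<phi> \<bullet> lift (x0 + x) + \<phi> \<bullet> lift (x0 + y) = 2 * t"
        by (simp add: move t_def d(3) inner_add_right)
      then have t: "0 \<le> t" "\<phi> \<bullet> lift (x0 + x) \<le> 2 * t" "\<phi> \<bullet> lift (x0 + y) \<le> 2 * t"
        using nonneg[OF cl(1)] nonneg[OF cl(2)] by linarith+
      show ?thesis
      proof (cases "2 * t < 1")
        case False
        then show ?thesis using half by (simp add: t_def)
      next
        case True
        have \<epsilon>_le: "\<epsilon> * r \<le> norm ((x0 + x) - (x0 + y))"
        proof -
          have "\<epsilon> \<le> norm (x - y) / r"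
            using xy(3) minkowski_le_norm[OF r, of "x - y"] by (rule order_trans)
          then show ?thesis using r(1) by (simp add: pos_le_divide_eq)
        qed
        \<comment> \<open>The cap estimate needs a positive level, but \<open>t\<close> may be 0. So
          it is applied at every level \<open>\<tau>\<close> strictly between \<open>2 * t\<close>
          and 1.\<close>
        have "(r / C) powr \<beta> * \<epsilon> powr \<beta> \<le> 2 * t"
        proof (rule dense_ge_bounded[OF True])
          fix \<tau> assume \<tau>: "2 * t < \<tau>" "\<tau> < 1"
          have "\<epsilon> * r \<le> C * \<tau> powr \<gamma>"
            using \<epsilon>_le cap[OF \<phi>(1) x0 p \<phi>(2,3) _ \<tau>(2) cl] \<tau>(1) t by force
          then have "r / C * \<epsilon> \<le> \<tau> powr \<gamma>"
            using C by (simp add: field_simps)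
          then have "(r / C * \<epsilon>) powr \<beta> \<le> (\<tau> powr \<gamma>) powr \<beta>"
            using r C \<epsilon> \<beta> by (intro powr_mono2) auto
          also have "\<dots> = \<tau>"
            using \<gamma> \<tau> t(1) by (simp add: powr_powr \<beta>_def)
          finally show "(r / C) powr \<beta> * \<epsilon> powr \<beta> \<le> \<tau>"
            using r C \<epsilon> by (subst powr_mult[symmetric]) auto
        qed
        moreover have "c * \<epsilon> powr \<beta> \<le> (r / C) powr \<beta> / 2 * \<epsilon> powr \<beta>"
          by (intro mult_right_mono) (auto simp: c_def)
        ultimately show ?thesis by (simp add: t_def)
      qed
    qed
  qed
  then have "ereal (c * \<epsilon> powr \<beta>) \<le> modulus_of_convexity ?N \<epsilon>" if "\<epsilon> \<in> {0..2}" for \<epsilon>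
    unfolding modulus_of_convexity_def using that by (intro Inf_greatest) auto
  then show ?thesis using \<beta> c by blast
qed

end

subsection \<open>Divisible domains\<close>

text \<open>The danger is a denominator \<open>j\<close> vanishing on the boundary. Boundedness of
  the image gives \<open>norm (g *v lift x) \<le> (1 + R) * \<bar>j x\<bar>\<close> on
  \<open>\<Omega>\<close>, hence on the closure, so a zero of \<open>j\<close> would contradict
  injectivity of \<open>g\<close>.\<close>

lemma pact_extends_to_closure:
  fixes g :: "real^('n::finite option)^('n option)"
  assumes "convex \<Omega>" "bounded \<Omega>" "invertible g" and m: "m \<in> \<Omega>"
    and nz: "\<And>x. x \<in> \<Omega> \<Longrightarrow> (g *v lift x) $ None \<noteq> 0" and img: "pact g ` \<Omega> = \<Omega>"
  shows "\<exists>T \<alpha>. linear T \<and> inj T \<and> \<alpha> m = (1::real) \<and> (\<forall>x\<in>closure \<Omega>. 0 < \<alpha> x \<and> pact g x \<in> closure \<Omega> \<and>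
      T (lift x) = \<alpha> x *\<^sub>R lift (pact g x)) \<and> (\<forall>x\<in>closure \<Omega> - \<Omega>. pact g x \<notin> \<Omega>)"
proof -
  define j where "j x = (g *v lift x) $ None" for x
  have jm: "j m \<noteq> 0" using nz m by (simp add: j_def)
  have inj: "inj ((*v) g)"
    using \<open>invertible g\<close> by (simp add: inj_matrix_vector_mult)
  have cont: "continuous_on S (\<lambda>x. g *v lift x)" for S
    by (intro continuous_on_compose2[OF matrix_vector_mult_linear_continuous_on] continuous_intros) auto
  have cont_j: "continuous_on S j" for S
    unfolding j_def by (intro continuous_intros cont)
  have j_affine: "j ((1 - u) *\<^sub>R x + u *\<^sub>R y) = (1 - u) * j x + u * j y" for u x y
    by (simp add: j_def lift_affine matrix_vector_right_distrib matrix_vector_mult_scaleR)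
  have pos: "j x / j m > 0" if x: "x \<in> \<Omega>" for x
  proof (rule ccontr)
    assume "\<not> j x / j m > 0"
    then have neg: "j x / j m < 0" using nz[OF x] jm by (auto simp: j_def not_less order_le_less)
    define h where "h = j x / j m"
    \<comment> \<open>The parameter at which the affine function \<open>j\<close> would vanish on
      the segment from \<open>x\<close> to \<open>m\<close>.\<close>
    define u where "u = h / (h - 1)"
    have u: "0 \<le> u" "u \<le> 1" "(1 - u) * h + u = 0"
      using neg by (auto simp: u_def h_def[symmetric] field_simps)
    have "(1 - u) *\<^sub>R x + u *\<^sub>R m \<in> \<Omega>"
      using \<open>convex \<Omega>\<close> x m u by (intro convexD) auto
    moreover have "j ((1 - u) *\<^sub>R x + u *\<^sub>R m) = ((1 - u) * h + u) * j m"
      using jm unfolding j_affine by (simp add: h_def field_simps)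
    ultimately show False using nz u(3) by (simp add: j_def)
  qed
  obtain R where R: "\<And>x. x \<in> \<Omega> \<Longrightarrow> norm x \<le> R"
    using \<open>bounded \<Omega>\<close> by (auto simp: bounded_iff)
  have norm_le: "norm (g *v lift x) - (1 + R) * \<bar>j x\<bar> \<le> 0" if "x \<in> closure \<Omega>" for x
  proof (rule continuous_le_on_closure[OF _ that])
    show "continuous_on (closure \<Omega>) (\<lambda>x. norm (g *v lift x) - (1 + R) * \<bar>j x\<bar>)"
      by (intro continuous_intros cont cont_j)
    fix x assume x: "x \<in> \<Omega>"
    have "norm (g *v lift x) = \<bar>j x\<bar> * norm (lift (pact g x))"
      unfolding j_def by (subst matrix_lift_eq_pact[OF nz[OF x]]) simp
    also have "\<dots> \<le> \<bar>j x\<bar> * (1 + R)"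
    proof (rule mult_left_mono)
      have "pact g x \<in> \<Omega>" using x img by blast
      then show "norm (lift (pact g x)) \<le> 1 + R"
        using R norm_lift_le[of "pact g x"] by fastforce
    qed simp
    finally show "norm (g *v lift x) - (1 + R) * \<bar>j x\<bar> \<le> 0" by (simp add: mult.commute)
  qed
  have j_nz: "j x \<noteq> 0" if "x \<in> closure \<Omega>" for x
  proof
    assume "j x = 0"
    then have "g *v lift x = g *v 0" using norm_le[OF that] by simp
    then have "lift x = 0" using inj by (simp only: inj_eq)
    then have "lift x $ None = 0" by simp
    then show False by simp
  qed
  have pos_closure: "0 < j x / j m" if "x \<in> closure \<Omega>" for x
  proof -
    have "0 \<le> j x / j m"
    proof (rule continuous_ge_on_closure[OF _ that])
      show "continuous_on (closure \<Omega>) (\<lambda>x. j x / j m)"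
        using jm by (intro continuous_intros cont_j) auto
    qed (use pos in force)
    then show ?thesis using j_nz[OF that] jm by (simp add: order_less_le)
  qed
  have g_lift: "g *v lift x = j x *\<^sub>R lift (pact g x)" if "x \<in> closure \<Omega>" for x
    using matrix_lift_eq_pact j_nz[OF that] by (simp add: j_def)
  have "continuous_on (closure \<Omega>) (pact g)"
    unfolding pact_def using j_nz by (intro continuous_intros cont) (auto simp: j_def)
  then have closure_img: "pact g ` closure \<Omega> \<subseteq> closure \<Omega>"
    by (rule image_closure_subset) (use img closure_subset in auto)
  \<comment> \<open>\<open>pact g\<close> is injective on the closure: equal images make the lifts
    proportional, and coordinate \<open>None\<close> shows that the factor is 1.\<close>
  have boundary: "pact g x \<notin> \<Omega>" if "x \<in> closure \<Omega> - \<Omega>" for x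
  proof
    assume "pact g x \<in> \<Omega>"
    then obtain y where y: "y \<in> \<Omega>" "pact g x = pact g y" using img by (metis imageE)
    then have "y \<in> closure \<Omega>" using closure_subset by blast
    have "g *v (j y *\<^sub>R lift x) = g *v (j x *\<^sub>R lift y)"
      using g_lift[of x] g_lift[OF \<open>y \<in> closure \<Omega>\<close>] that y(2) by (simp add: matrix_vector_mult_scaleR)
    then have eq: "j y *\<^sub>R lift x = j x *\<^sub>R lift y" using inj by (simp only: inj_eq)
    have "j y = j x" using arg_cong[OF eq, of "\<lambda>v. v $ None"] by simp
    from eq[unfolded this] have "x = y" using j_nz[of x] that by simp
    then show False using that y(1) by simp
  qed
  show ?thesis
  proof (rule exI[of _ "\<lambda>y. (1 / j m) *\<^sub>R (g *v y)"], rule exI[of _ "\<lambda>x. j x / j m"],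
      intro conjI ballI)
    show "linear (\<lambda>y. (1 / j m) *\<^sub>R (g *v y))"
      by (intro linear_compose_scale_right matrix_vector_mul_linear)
    show "inj (\<lambda>y. (1 / j m) *\<^sub>R (g *v y))"
      using inj jm by (auto simp: inj_def)
    show "j m / j m = 1" using jm by simp
    fix x assume x: "x \<in> closure \<Omega>"
    show "0 < j x / j m" by (rule pos_closure[OF x])
    show "pact g x \<in> closure \<Omega>" using closure_img x by blast
    show "(1 / j m) *\<^sub>R (g *v lift x) = (j x / j m) *\<^sub>R lift (pact g x)"
      by (simp add: g_lift[OF x])
  qed (rule boundary)
qed

lemma divisible_imp_strictly_convex_cocompact:
  fixes \<Omega> :: "(real^'n) set"
  assumes "divisible \<Omega>" and "strictly_convex \<Omega>"
  shows "\<exists>K. strictly_convex_cocompact \<Omega> K"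
proof -
  obtain \<Gamma> K where \<Gamma>: "proj_group \<Gamma>" "preserves \<Gamma> \<Omega>"
    and K: "compact K" "K \<subseteq> \<Omega>" "(\<Union>g\<in>\<Gamma>. pact g ` K) = \<Omega>"
    using assms(1) unfolding divisible_def by blast
  have \<Omega>: "open \<Omega>" "convex \<Omega>" "bounded \<Omega>"
    and strict: "\<And>a b. a \<noteq> b \<Longrightarrow> \<not> closed_segment a b \<subseteq> frontier \<Omega>"
    using assms(2) unfolding strictly_convex_def properly_convex_open_def by blast+
  have "strictly_convex_cocompact \<Omega> K"
  proof
    fix m assume m: "m \<in> \<Omega>"
    then obtain g k where g: "g \<in> \<Gamma>" and k: "k \<in> K" "m = pact g k" using K(3) by blast
    \<comment> \<open>\<open>m\<close> is the image of a core point \<open>k\<close> under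
      \<open>g\<close>, so the inverse moves \<open>m\<close> back into the core.\<close>
    define h where "h = matrix_inv g"
    have inv: "invertible g" "h \<in> \<Gamma>" using \<Gamma>(1) g by (auto simp: proj_group_def h_def)
    then have h_inv: "invertible h" using \<Gamma>(1) by (auto simp: proj_group_def)
    have gnz: "(g *v lift k) $ None \<noteq> 0"
      using \<Gamma>(2) g k K(2) by (auto simp: preserves_def)
    have "h ** g = mat 1"
      using someI_ex[OF inv(1)[unfolded invertible_def]] by (simp add: h_def matrix_inv_def)
    then have "h *v (g *v lift k) = lift k"
      by (simp add: matrix_vector_mul_assoc)
    moreover have "g *v lift k = (g *v lift k) $ None *\<^sub>R lift m"
      using matrix_lift_eq_pact[OF gnz] k(2) by simp
    ultimately have lift_k: "lift k = (g *v lift k) $ None *\<^sub>R (h *v lift m)"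
      by (metis matrix_vector_mult_scaleR)
    have "h *v lift m = (1 / (g *v lift k) $ None) *\<^sub>R ((g *v lift k) $ None *\<^sub>R (h *v lift m))"
      using gnz by simp
    then have "h *v lift m = (1 / (g *v lift k) $ None) *\<^sub>R lift k"
      by (simp only: lift_k[symmetric])
    then have hm: "pact h m = k"
      by (rule pact_eqI) (use gnz in simp)
    have img: "pact h ` \<Omega> = \<Omega>" and nz: "\<And>x. x \<in> \<Omega> \<Longrightarrow> (h *v lift x) $ None \<noteq> 0"
      using \<Gamma>(2) inv(2) by (auto simp: preserves_def)
    obtain T \<alpha> where "linear T" "inj T" "\<alpha> m = (1::real)" "\<forall>x\<in>closure \<Omega>. 0 < \<alpha> x \<and> pact h x \<in> closure \<Omega> \<and>
      T (lift x) = \<alpha> x *\<^sub>R lift (pact h x)" "\<forall>x\<in>closure \<Omega> - \<Omega>. pact h x \<notin> \<Omega>"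
      using pact_extends_to_closure[OF \<Omega>(2,3) h_inv m nz img] by blast
    then show "\<exists>T \<alpha> G. linear T \<and> inj T \<and>
      (\<forall>x\<in>closure \<Omega>. 0 < \<alpha> x \<and> G x \<in> closure \<Omega> \<and> T (lift x) = \<alpha> x *\<^sub>R lift (G x)) \<and>
      \<alpha> m = 1 \<and> G m \<in> K \<and> G ` \<Omega> = \<Omega> \<and> (\<forall>x\<in>closure \<Omega> - \<Omega>. G x \<notin> \<Omega>)"
      using hm k(1) img by (intro exI[of _ T] exI[of _ \<alpha>] exI[of _ "pact h"]) simp
  qed (use \<Omega> strict K in auto)
  then show ?thesis ..
qed

theorem theorem1p1:
  fixes \<Omega> :: "(real^'n) set" and x0 :: "real^'n"
  assumes "divisible \<Omega>" and "strictly_convex \<Omega>" and "x0 \<in> \<Omega>"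
  shows "\<exists>\<beta> C. \<beta> \<ge> 2 \<and> C > 0 \<and>
     (\<forall>\<epsilon>\<in>{0..2}. modulus_of_convexity (minkowski \<Omega> x0) \<epsilon> \<ge> ereal (C * \<epsilon> powr \<beta>))"
proof -
  obtain K where "strictly_convex_cocompact \<Omega> K"
    using divisible_imp_strictly_convex_cocompact[OF assms(1,2)] ..
  then show ?thesis
    using assms(3) by (rule strictly_convex_cocompact.minkowski_uniformly_convex)
qed

end
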